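(* Let $x$ be a fixed-point-free involution in $S_{2n}$. Then $\mathcal{A}_{\mathrm{FPF}}(x)^{-1}=\{u\in S_{2n}:\hat0_{\mathrm{FPF}}(x)\preceq_{\mathcal{A}_{\mathrm{FPF}}}u\}=\{u\in S_{2n}:u\preceq_{\mathcal{A}_{\mathrm{FPF}}}\hat1_{\mathrm{FPF}}(x)\}$.
   Context: $S_{2n}$ has simple generators $s_i=(i,i+1)$ and length $\ell$; permutations are identified with one-line sequences. The Demazure product $\circ$ is the unique associative operation on $S_{2n}$ with $s\circ w = sw$ if $\ell(sw)>\ell(w)$ and $s\circ w=w$ otherwise, and $w\circ s=ws$ if $\ell(ws)>\ell(w)$ and $w\circ s = w$ otherwise. Let $w_{\mathrm{fpf}}=s_1s_3\cdots s_{2n-1}$; $\mathcal{A}_{\mathrm{FPF}}(x)$ is the set of minimal-length $w\in S_{2n}$ with $w^{-1}\circ w_{\mathrm{fpf}}\circ w=x$, and $\mathcal{A}_{\mathrm{FPF}}(x)^{-1}=\{u^{-1}:u\in\mathcal{A}_{\mathrm{FPF}}(x)\}$. $\prec_{\mathcal{A}_{\mathrm{FPF}}}$ is the transitive closure of the relation on length-$2n$ integer sequences in which a sequence with $[a,d,b,c]$ in positions $2i-1,2i,2i+1,2i+2$ precedes the sequence with $[b,c,a,d]$ in those positions (all other entries equal), whenever $a\le b\le c\le d$; $\preceq$ means $\prec$ or equal. List the pairs $\{(a,b):a<b=x(a)\}$ as $(a_1,b_1),\dots,(a_n,b_n)$ with $a_1<\dots<a_n$, and as $(c_1,d_1),\dots,(c_n,d_n)$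 with $d_1<\dots<d_n$. Then $\hat0_{\mathrm{FPF}}(x)=[a_1,b_1,\dots,a_n,b_n]$ and $\hat1_{\mathrm{FPF}}(x)=[c_1,d_1,\dots,c_n,d_n]$. *)

theory Defs
  imports "HOL-Combinatorics.Permutations" "HOL-Library.FuncSet"
begin

text \<open>\<open>S\<^sub>N\<close> is realised as the permutations of \<open>{1..N}\<close>, extended by the identity to all of
  \<^typ>\<open>nat\<close>; the group product \<open>u v\<close> is \<open>u \<circ> v\<close> (first \<open>v\<close>, then \<open>u\<close>).\<close>

definition Sym :: "nat \<Rightarrow> (nat \<Rightarrow> nat) set" where
  "Sym N = {w. w permutes {1..N}}"

definition simple_refl :: "nat \<Rightarrow> nat \<Rightarrow> nat" where
  "simple_refl i = transpose i (i + 1)"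

definition word_perm :: "nat list \<Rightarrow> nat \<Rightarrow> nat" where
  "word_perm is = foldr (\<lambda>i u. simple_refl i \<circ> u) is id"

definition cox_length :: "nat \<Rightarrow> (nat \<Rightarrow> nat) \<Rightarrow> nat" where
  "cox_length N w = (LEAST k. \<exists>is. set is \<subseteq> {1..<N} \<and> length is = k \<and> word_perm is = w)"

text \<open>The identity law follows from the other conditions unless \<open>N = 2\<close>; there the constant
  operation \<open>(u, v) \<mapsto> s\<^sub>1\<close> is also associative and satisfies both multiplication rules, so the
  law is needed for uniqueness. The values outside \<open>S\<^sub>N\<close> are fixed by extensionality.\<close>

definition is_demazure :: "nat \<Rightarrow> ((nat \<Rightarrow> nat) \<Rightarrow> (nat \<Rightarrow> nat) \<Rightarrow> (nat \<Rightarrow> nat)) \<Rightarrow> bool" where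
  "is_demazure N f \<longleftrightarrow>
     f \<in> Sym N \<rightarrow>\<^sub>E (Sym N \<rightarrow>\<^sub>E Sym N) \<and>
     (\<forall>u\<in>Sym N. \<forall>v\<in>Sym N. \<forall>w\<in>Sym N. f (f u v) w = f u (f v w)) \<and>
     (\<forall>w\<in>Sym N. f id w = w \<and> f w id = w) \<and>
     (\<forall>i\<in>{1..<N}. \<forall>w\<in>Sym N.
        f (simple_refl i) w =
          (if cox_length N (simple_refl i \<circ> w) > cox_length N w then simple_refl i \<circ> w else w) \<and>
        f w (simple_refl i) =
          (if cox_length N (w \<circ> simple_refl i) > cox_length N w then w \<circ> simple_refl i else w))"

definition demazure :: "nat \<Rightarrow> (nat \<Rightarrow> nat) \<Rightarrow> (nat \<Rightarrow> nat) \<Rightarrow> (nat \<Rightarrow> nat)" where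
  "demazure N = (THE f. is_demazure N f)"

definition w_fpf :: "nat \<Rightarrow> nat \<Rightarrow> nat" where
  "w_fpf n = word_perm (map (\<lambda>i. 2 * i - 1) [1..<n + 1])"

definition fpf_conjugators :: "nat \<Rightarrow> (nat \<Rightarrow> nat) \<Rightarrow> (nat \<Rightarrow> nat) set" where
  "fpf_conjugators n x =
     {w \<in> Sym (2 * n). demazure (2 * n) (demazure (2 * n) (inv w) (w_fpf n)) w = x}"

definition A_FPF :: "nat \<Rightarrow> (nat \<Rightarrow> nat) \<Rightarrow> (nat \<Rightarrow> nat) set" where
  "A_FPF n x = {w \<in> fpf_conjugators n x.
     \<forall>v\<in>fpf_conjugators n x. cox_length (2 * n) w \<le> cox_length (2 * n) v}"

definition one_line :: "nat \<Rightarrow> (nat \<Rightarrow> nat) \<Rightarrow> int list" where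
  "one_line N w = map (\<lambda>i. int (w i)) [1..<N + 1]"

text \<open>The four entries occupy positions \<open>2i-1, 2i, 2i+1, 2i+2\<close> (counted from 1) exactly when
  the prefix before them has even length.\<close>

definition fpf_step :: "nat \<Rightarrow> int list \<Rightarrow> int list \<Rightarrow> bool" where
  "fpf_step n p q \<longleftrightarrow> length p = 2 * n \<and> length q = 2 * n \<and>
     (\<exists>us vs a b c d. even (length us) \<and> a \<le> b \<and> b \<le> c \<and> c \<le> d \<and>
        p = us @ [a, d, b, c] @ vs \<and> q = us @ [b, c, a, d] @ vs)"

definition fpf_less :: "nat \<Rightarrow> int list \<Rightarrow> int list \<Rightarrow> bool" where
  "fpf_less n = (fpf_step n)\<^sup>+\<^sup>+"

definition fpf_le :: "nat \<Rightarrow> int list \<Rightarrow> int list \<Rightarrow> bool" where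
  "fpf_le n p q \<longleftrightarrow> fpf_less n p q \<or> p = q"

definition cycle_pairs :: "nat \<Rightarrow> (nat \<Rightarrow> nat) \<Rightarrow> (nat \<times> nat) set" where
  "cycle_pairs n x = {(a, b). a \<in> {1..2 * n} \<and> b \<in> {1..2 * n} \<and> a < b \<and> b = x a}"

definition flatten_pairs :: "(nat \<times> nat) list \<Rightarrow> int list" where
  "flatten_pairs ps = concat (map (\<lambda>(a, b). [int a, int b]) ps)"

definition zero_FPF :: "nat \<Rightarrow> (nat \<Rightarrow> nat) \<Rightarrow> int list" where
  "zero_FPF n x = flatten_pairs (sorted_key_list_of_set fst (cycle_pairs n x))"

definition one_FPF :: "nat \<Rightarrow> (nat \<Rightarrow> nat) \<Rightarrow> int list" where
  "one_FPF n x = flatten_pairs (sorted_key_list_of_set snd (cycle_pairs n x))"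

definition fpf_involution :: "nat \<Rightarrow> (nat \<Rightarrow> nat) \<Rightarrow> bool" where
  "fpf_involution n x \<longleftrightarrow> x \<in> Sym (2 * n) \<and> x \<circ> x = id \<and> (\<forall>i\<in>{1..2 * n}. x i \<noteq> i)"

end

(*
  Write w as the inverse of u. Along a word of w, each simple reflection either conjugates the
  current fixed-point-free involution, raising its length by 2, or leaves it unchanged. Hence
  w is a shortest conjugator exactly when the length always rises by 2. This happens if and only if
  the list of pairs (u 1, u 2), (u 3, u 4), ... consists of the arcs of x, each written in increasing
  order, with no arc preceded by one that is larger in both endpoints: u is a linear extension of
  the componentwise order on arcs. Two arcs are incomparable exactly when they are nested, and the
  moves of fpf_step exchange two adjacent nested arcs. Bubble sort by left endpoints therefore
  connects every linear extension to the least element, and by right endpoints to the greatest one.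
*)

theory Submission
  imports Defs
begin

section \<open>Simple reflections and inversions\<close>

text \<open>The increase of 2 rests on the absence of fixed points: multiplying y on the left by
  \<open>simple_refl i\<close> could spoil the ascent on the right only if y fixed both
  \<open>i\<close> and \<open>i + 1\<close>. So both multiplications take effect or neither does. A
  step that leaves y unchanged is a loss that later steps cannot repair, because no step gains more
  than 2.

  The inverse u is tracked because \<open>simple_refl i \<circ> u\<close> exchanges the values
  \<open>i\<close> and \<open>i + 1\<close> while the positions keep their pairing into consecutive
  blocks. Only one comparison of values changes, so its effect on the order of the arcs can be read
  off.

  An upper bound on the gain identifies the shortest conjugators only if it is attained for every x.
  The permutation with one-line form \<open>zero_FPF n x\<close> provides this: its inverse attains
  the bound.

  Two definitions have to be made usable beforehand. \<open>demazure\<close> is a definite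
  description, so existence and uniqueness precede every rule for it; \<open>cox_length\<close> is a
  minimum over words and is replaced by a count of inversions.\<close>

lemma simple_refl_apply:
  "simple_refl i m = (if m = i then i + 1 else if m = i + 1 then i else m)"
  by (simp add: simple_refl_def transpose_def)

lemma simple_refl_invol [simp]: "simple_refl i (simple_refl i m) = m"
  by (simp add: simple_refl_apply)

lemma simple_refl_cancel_right [simp]: "(w \<circ> simple_refl i) \<circ> simple_refl i = w"
  by (simp add: fun_eq_iff)

lemma bij_simple_refl: "bij (simple_refl i)"
  by (simp add: simple_refl_def)

lemma inv_simple_refl [simp]: "inv (simple_refl i) = simple_refl i"
  by (simp add: simple_refl_def)

lemma simple_refl_less_iff:
  "simple_refl i a < simple_refl i b \<longleftrightarrow> a < b \<and> \<not> (a = i \<and> b = i + 1) \<or> a = i + 1 \<and> b = i"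
  by (auto simp: simple_refl_apply)

lemma id_in_Sym [simp]: "id \<in> Sym N"
  by (simp add: Sym_def permutes_id)

lemma simple_refl_in_Sym: "i \<in> {1..<N} \<Longrightarrow> simple_refl i \<in> Sym N"
  unfolding Sym_def simple_refl_def by (simp add: permutes_swap_id)

lemma comp_in_Sym: "u \<in> Sym N \<Longrightarrow> v \<in> Sym N \<Longrightarrow> u \<circ> v \<in> Sym N"
  unfolding Sym_def using permutes_compose by blast

lemma inv_in_Sym: "u \<in> Sym N \<Longrightarrow> inv u \<in> Sym N"
  unfolding Sym_def using permutes_inv by blast

lemma bij_Sym: "u \<in> Sym N \<Longrightarrow> bij u"
  unfolding Sym_def using permutes_bij by blast

lemma inv_inv_Sym: "u \<in> Sym N \<Longrightarrow> inv (inv u) = u"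
  by (rule inv_inv_eq[OF bij_Sym])

lemma Sym_inv_apply:
  assumes "u \<in> Sym N"
  shows "u (inv u m) = m" "inv u (u m) = m"
proof -
  have "u permutes {1..N}" using assms by (simp add: Sym_def)
  from permutes_inverses[OF this] show "u (inv u m) = m" "inv u (u m) = m" .
qed

lemma Sym_eq_iff: "u \<in> Sym N \<Longrightarrow> u a = u b \<longleftrightarrow> a = b"
  by (rule inj_eq[OF bij_is_inj[OF bij_Sym]])

lemma Sym_in_range: "u \<in> Sym N \<Longrightarrow> u m \<in> {1..N} \<longleftrightarrow> m \<in> {1..N}"
  by (rule permutes_in_image) (simp add: Sym_def)

lemma Sym_outside: "u \<in> Sym N \<Longrightarrow> m \<notin> {1..N} \<Longrightarrow> u m = m"
  by (rule permutes_not_in[of u "{1..N}"]) (simp_all add: Sym_def)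

lemma inv_comp_refl_Sym:
  assumes "w \<in> Sym N"
  shows "inv (w \<circ> simple_refl i) = simple_refl i \<circ> inv w"
    and "inv (simple_refl i \<circ> w) = inv w \<circ> simple_refl i"
  using o_inv_distrib[OF bij_Sym[OF assms] bij_simple_refl]
    o_inv_distrib[OF bij_simple_refl bij_Sym[OF assms]] by simp_all

text \<open>The pairs range over all naturals, so no bound \<open>N\<close> enters. Finiteness then
  has to come from \<open>w\<close> being the identity outside \<open>{1..N}\<close>.\<close>

definition inversions :: "(nat \<Rightarrow> nat) \<Rightarrow> (nat \<times> nat) set" where
  "inversions w = {(a, b). a < b \<and> w b < w a}"

definition inv_num :: "(nat \<Rightarrow> nat) \<Rightarrow> nat" where
  "inv_num w = card (inversions w)"

lemma finite_inversions:
  assumes "w \<in> Sym N"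
  shows "finite (inversions w)"
proof -
  have "a \<in> {1..N} \<and> b \<in> {1..N}" if *: "a < b" "w b < w a" for a b
  proof -
    have b: "b \<le> N"
    proof (rule ccontr)
      assume "\<not> b \<le> N"
      then have "w b = b" using Sym_outside[OF assms] by simp
      with * have "w a \<noteq> a" "\<not> w a \<le> N" using \<open>\<not> b \<le> N\<close> by auto
      then show False using Sym_outside[OF assms, of a] Sym_in_range[OF assms, of a] by auto
    qed
    have "1 \<le> a"
    proof (rule ccontr)
      assume "\<not> 1 \<le> a"
      then have "w a = 0" using Sym_outside[OF assms, of a] by simp
      with * show False by simp
    qed
    with * b show ?thesis by simp
  qed
  then have "inversions w \<subseteq> {1..N} \<times> {1..N}"
    by (auto simp: inversions_def)
  then show ?thesis by (rule finite_subset) simp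
qed

text \<open>Applying \<open>simple_refl i\<close> to both positions carries the inversions of
  \<open>w\<close> onto those of \<open>w \<circ> simple_refl i\<close> other than
  \<open>(i, i + 1)\<close>, the only pair of positions whose order it reverses.\<close>

lemma inv_num_ascent:
  assumes w: "w \<in> Sym N" and less: "w i < w (i + 1)"
  shows "inv_num (w \<circ> simple_refl i) = inv_num w + 1"
proof -
  let ?s = "simple_refl i"
  have image_iff: "(a, b) \<in> map_prod ?s ?s ` M \<longleftrightarrow> (?s a, ?s b) \<in> M" for a b M
    by (force simp: image_iff)
  have eq: "inversions (w \<circ> ?s) = insert (i, i + 1) (map_prod ?s ?s ` inversions w)" (is "?A = ?B")
  proof (rule set_eqI)
    fix z :: "nat \<times> nat"
    obtain a b where z: "z = (a, b)" by (cases z)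
    show "z \<in> ?A \<longleftrightarrow> z \<in> ?B"
      using less image_iff[of a b]
      by (auto simp: z inversions_def simple_refl_less_iff) (auto simp: simple_refl_apply)
  qed
  have "(i, i + 1) \<notin> map_prod ?s ?s ` inversions w"
    unfolding image_iff by (simp add: inversions_def simple_refl_apply)
  moreover have "card (map_prod ?s ?s ` inversions w) = card (inversions w)"
    by (rule card_image) (auto intro!: inj_onI simp: Sym_eq_iff dest: injD[OF bij_is_inj[OF bij_simple_refl]])
  ultimately show ?thesis
    using finite_inversions[OF w] unfolding inv_num_def eq by simp
qed

lemma inv_num_inv:
  assumes w: "w \<in> Sym N"
  shows "inv_num (inv w) = inv_num w"
proof -
  have "bij_betw (\<lambda>(a, b). (w b, w a)) (inversions w) (inversions (inv w))"
    by (rule bij_betw_byWitness[where f' = "\<lambda>(a, b). (inv w b, inv w a)"])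
      (auto simp: inversions_def Sym_inv_apply[OF w])
  then show ?thesis
    unfolding inv_num_def by (rule bij_betw_same_card[symmetric])
qed

lemma inv_num_ascent_left:
  assumes w: "w \<in> Sym N" and i: "i \<in> {1..<N}" and "inv w i < inv w (i + 1)"
  shows "inv_num (simple_refl i \<circ> w) = inv_num w + 1"
proof -
  have "inv_num (simple_refl i \<circ> w) = inv_num (inv w \<circ> simple_refl i)"
    using inv_num_inv[OF comp_in_Sym[OF simple_refl_in_Sym[OF i] w]]
    by (simp add: inv_comp_refl_Sym[OF w])
  then show ?thesis
    using inv_num_ascent[OF inv_in_Sym[OF w] assms(3)] inv_num_inv[OF w] by simp
qed

lemma Sym_neq_Suc: "w \<in> Sym N \<Longrightarrow> w i \<noteq> w (i + 1)"
  using Sym_eq_iff[of w N i "i + 1"] by simp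

lemma id_if_no_descent:
  assumes w: "w \<in> Sym N" and asc: "\<And>i. i \<in> {1..<N} \<Longrightarrow> w i < w (i + 1)"
  shows "w = id"
proof (rule permutes_natset_ge)
  show "w permutes {1..N}" using w by (simp add: Sym_def)
  have "1 \<le> m \<longrightarrow> m \<le> N \<longrightarrow> m \<le> w m" for m
  proof (induction m)
    case (Suc m)
    show ?case
    proof (cases "m = 0")
      case True
      then show ?thesis using Sym_in_range[OF w, of 1] by auto
    next
      case False
      then show ?thesis using Suc asc[of m] by auto
    qed
  qed simp
  then show "\<forall>m\<in>{1..N}. m \<le> w m" by auto
qed

text \<open>Induction along reduced words without mentioning words: a permutation other than
  \<open>id\<close> has a descent, and cancelling it lowers \<open>inv_num\<close>.\<close>

lemma Sym_induct [consumes 1, case_names id ascent]: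
  assumes "w \<in> Sym N" and "P id"
    and step: "\<And>w i. w \<in> Sym N \<Longrightarrow> i \<in> {1..<N} \<Longrightarrow> w i < w (i + 1) \<Longrightarrow> P w \<Longrightarrow> P (w \<circ> simple_refl i)"
  shows "P w"
  using assms(1)
proof (induction "inv_num w" arbitrary: w rule: less_induct)
  case less
  show ?case
  proof (cases "\<forall>i\<in>{1..<N}. w i < w (i + 1)")
    case True
    then show ?thesis using id_if_no_descent[OF less.prems] \<open>P id\<close> by simp
  next
    case False
    then obtain i where i: "i \<in> {1..<N}" "\<not> w i < w (i + 1)" by blast
    let ?v = "w \<circ> simple_refl i"
    have v: "?v \<in> Sym N" using less.prems i simple_refl_in_Sym comp_in_Sym by blast
    have asc: "?v i < ?v (i + 1)"
      using i Sym_neq_Suc[OF less.prems, of i] by (simp add: simple_refl_apply)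
    have "inv_num w = inv_num ?v + 1" using inv_num_ascent[of ?v N i] v asc by simp
    then have "P ?v" using less.hyps[of ?v] v by simp
    from step[OF v i(1) asc this] show ?thesis by simp
  qed
qed

lemma Sym_induct_left [consumes 1, case_names id ascent]:
  assumes "w \<in> Sym N" and "P id"
    and step: "\<And>w i. w \<in> Sym N \<Longrightarrow> i \<in> {1..<N} \<Longrightarrow> inv w i < inv w (i + 1) \<Longrightarrow> P w \<Longrightarrow> P (simple_refl i \<circ> w)"
  shows "P w"
proof -
  have "P (inv v)" if "v \<in> Sym N" for v
    using that
  proof (induction v rule: Sym_induct)
    case id
    have "P (inv id)" using \<open>P id\<close> by simp
    then show ?case .
  next
    case (ascent v i)
    note v = inv_comp_refl_Sym(1)[OF ascent.hyps(1)] inv_in_Sym[OF ascent.hyps(1)]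
      inv_inv_Sym[OF ascent.hyps(1)]
    have "P (inv (v \<circ> simple_refl i))"
      unfolding v by (rule step) (use ascent v in simp_all)
    then show ?case .
  qed
  from this[OF inv_in_Sym[OF assms(1)]] show ?thesis by (simp add: inv_inv_Sym[OF assms(1)])
qed

lemma inv_num_id [simp]: "inv_num id = 0"
proof -
  have "inversions id = {}" by (auto simp: inversions_def)
  then show ?thesis by (simp add: inv_num_def)
qed

lemma inv_num_descent:
  assumes w: "w \<in> Sym N" and i: "i \<in> {1..<N}" and desc: "w (i + 1) < w i"
  shows "inv_num w = inv_num (w \<circ> simple_refl i) + 1"
proof -
  have "w \<circ> simple_refl i \<in> Sym N" using w i simple_refl_in_Sym comp_in_Sym by blast
  from inv_num_ascent[OF this, of i] desc show ?thesis by (simp add: simple_refl_apply)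
qed

section \<open>Words in the simple reflections and the length function\<close>

lemma word_perm_simps [simp]:
  "word_perm [] = id" "word_perm (i # is) = simple_refl i \<circ> word_perm is"
  by (simp_all add: word_perm_def)

lemma word_perm_append: "word_perm (is @ js) = word_perm is \<circ> word_perm js"
  by (induction "is") (simp_all add: o_assoc)

lemma word_perm_in_Sym: "set is \<subseteq> {1..<N} \<Longrightarrow> word_perm is \<in> Sym N"
proof (induction "is")
  case (Cons i "is")
  then have "simple_refl i \<in> Sym N" "word_perm is \<in> Sym N" by (simp_all add: simple_refl_in_Sym)
  then show "word_perm (i # is) \<in> Sym N" by (simp add: comp_in_Sym)
qed simp

lemma inv_num_word_perm_le: "set is \<subseteq> {1..<N} \<Longrightarrow> inv_num (word_perm is) \<le> length is"
proof (induction "is" rule: rev_induct)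
  case (snoc i "is")
  let ?w = "word_perm is"
  have "set is \<subseteq> {1..<N}" and i: "i \<in> {1..<N}" using snoc.prems by auto
  from word_perm_in_Sym[OF this(1)] have w: "?w \<in> Sym N" .
  have "inv_num (?w \<circ> simple_refl i) \<le> inv_num ?w + 1"
    using inv_num_ascent[OF w, of i] inv_num_descent[OF w i] Sym_neq_Suc[OF w, of i]
    by (cases "?w i < ?w (i + 1)") auto
  then have "inv_num (word_perm (is @ [i])) \<le> length (is @ [i])"
    using snoc by (simp add: word_perm_append)
  then show ?case .
qed simp

text \<open>A word of this length is collected along the ascents of \<open>Sym_induct\<close>, each
  of which adds exactly one inversion. No word is shorter, since a letter never adds more than
  one.\<close>

lemma cox_length_eq_inv_num:
  assumes "w \<in> Sym N"
  shows "cox_length N w = inv_num w"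
  unfolding cox_length_def
proof (rule Least_equality)
  show "\<exists>is. set is \<subseteq> {1..<N} \<and> length is = inv_num w \<and> word_perm is = w"
    using assms
  proof (induction w rule: Sym_induct)
    case (ascent w i)
    then obtain "is" where "set is \<subseteq> {1..<N}" "length is = inv_num w" "word_perm is = w" by blast
    then have "set (is @ [i]) \<subseteq> {1..<N}" "length (is @ [i]) = inv_num (w \<circ> simple_refl i)"
      "word_perm (is @ [i]) = w \<circ> simple_refl i"
      using ascent.hyps inv_num_ascent[of w N i] by (simp_all add: word_perm_append)
    then show ?case by blast
  next
    case id
    show "\<exists>is. set is \<subseteq> {1..<N} \<and> length is = inv_num id \<and> word_perm is = id"
      by (intro exI[of _ "[]"]) simp
  qed
next
  fix k assume "\<exists>is. set is \<subseteq> {1..<N} \<and> length is = k \<and> word_perm is = w"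
  then show "inv_num w \<le> k" using inv_num_word_perm_le by blast
qed

lemma cox_length_less_iff:
  assumes w: "w \<in> Sym N" and i: "i \<in> {1..<N}"
  shows "cox_length N w < cox_length N (w \<circ> simple_refl i) \<longleftrightarrow> w i < w (i + 1)"
proof -
  have "w \<circ> simple_refl i \<in> Sym N" using w i simple_refl_in_Sym comp_in_Sym by blast
  then show ?thesis
    using inv_num_ascent[OF w, of i] inv_num_descent[OF w i] Sym_neq_Suc[OF w, of i]
    by (cases "w i < w (i + 1)") (auto simp: cox_length_eq_inv_num w)
qed

lemma cox_length_less_iff_left:
  assumes w: "w \<in> Sym N" and i: "i \<in> {1..<N}"
  shows "cox_length N w < cox_length N (simple_refl i \<circ> w) \<longleftrightarrow> inv w i < inv w (i + 1)"
proof -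
  have sw: "simple_refl i \<circ> w \<in> Sym N" using w i simple_refl_in_Sym comp_in_Sym by blast
  have "inv w \<circ> simple_refl i \<in> Sym N" using w i simple_refl_in_Sym comp_in_Sym inv_in_Sym by blast
  then show ?thesis
    using cox_length_less_iff[OF inv_in_Sym[OF w] i] inv_num_inv[OF w] inv_num_inv[OF sw]
    by (simp add: cox_length_eq_inv_num w sw inv_in_Sym inv_comp_refl_Sym[OF w])
qed

section \<open>Existence and uniqueness of the Demazure product\<close>

text \<open>The length test of the Demazure product is replaced by a comparison of positions:
  \<open>i\<close> stands before \<open>i + 1\<close> in the one-line form of
  \<open>w\<close>.\<close>

definition dem_left :: "nat \<Rightarrow> (nat \<Rightarrow> nat) \<Rightarrow> (nat \<Rightarrow> nat)" where
  "dem_left i w = (if inv w i < inv w (i + 1) then simple_refl i \<circ> w else w)"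

definition dem_right :: "nat \<Rightarrow> (nat \<Rightarrow> nat) \<Rightarrow> (nat \<Rightarrow> nat)" where
  "dem_right i w = (if w i < w (i + 1) then w \<circ> simple_refl i else w)"

lemma dem_in_Sym:
  assumes "w \<in> Sym N" "i \<in> {1..<N}"
  shows "dem_left i w \<in> Sym N" "dem_right i w \<in> Sym N"
  using assms by (simp_all add: dem_left_def dem_right_def comp_in_Sym simple_refl_in_Sym)

lemma foldr_dem_in_Sym:
  assumes "w \<in> Sym N" "set is \<subseteq> {1..<N}"
  shows "foldr dem_left is w \<in> Sym N" "foldr dem_right is w \<in> Sym N"
  using assms(2) by (induction "is") (simp_all add: assms(1) dem_in_Sym)

text \<open>The two ascent conditions only interact when \<open>w\<close> maps \<open>{j, j + 1}\<close> onto \<open>{i, i + 1}\<close>,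
  in which case \<open>s\<^sub>i w = w s\<^sub>j\<close>.\<close>

lemma dem_left_right_commute:
  assumes w: "w \<in> Sym N"
  shows "dem_left i (dem_right j w) = dem_right j (dem_left i w)"
proof -
  let ?s = "simple_refl i" and ?t = "simple_refl j"
  note inv_apply = Sym_inv_apply[OF w]
  have inv_eq: "inv w a = b \<longleftrightarrow> a = w b" for a b using inv_apply by metis
  consider (same) "w j = i" "w (j + 1) = i + 1" | (flip) "w j = i + 1" "w (j + 1) = i"
    | (generic) "\<not> (w j = i \<and> w (j + 1) = i + 1)" "\<not> (w j = i + 1 \<and> w (j + 1) = i)" by blast
  then show ?thesis
  proof cases
    case same
    then have "inv w i = j" "inv w (i + 1) = j + 1" by (simp_all add: inv_eq)
    moreover have "?s \<circ> w = w \<circ> ?t"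
      using same Sym_eq_iff[OF w] by (auto simp: fun_eq_iff simple_refl_apply) (metis Suc_eq_plus1)+
    ultimately show ?thesis
      using same by (simp add: dem_left_def dem_right_def inv_comp_refl_Sym[OF w])
        (simp add: simple_refl_apply)
  next
    case flip
    then have "inv w i = j + 1" "inv w (i + 1) = j" by (simp_all add: inv_eq)
    then show ?thesis
      using flip by (simp add: dem_left_def dem_right_def)
  next
    case generic
    have "?s (w j) < ?s (w (j + 1)) \<longleftrightarrow> w j < w (j + 1)"
      using generic by (auto simp: simple_refl_less_iff)
    moreover have "?t (inv w i) < ?t (inv w (i + 1)) \<longleftrightarrow> inv w i < inv w (i + 1)"
      using generic by (auto simp: simple_refl_less_iff inv_eq)
    ultimately show ?thesis
      by (simp add: dem_left_def dem_right_def inv_comp_refl_Sym[OF w] o_assoc)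
  qed
qed

lemma foldr_dem_commute:
  assumes "w \<in> Sym N" "set is \<subseteq> {1..<N}" "set js \<subseteq> {1..<N}"
  shows "foldr dem_left is (foldr dem_right js w) = foldr dem_right js (foldr dem_left is w)"
proof -
  have *: "dem_left i (foldr dem_right js v) = foldr dem_right js (dem_left i v)"
    if "v \<in> Sym N" for i v
    using assms(3)
  proof (induction js)
    case (Cons j js)
    then show ?case
      using dem_left_right_commute[OF foldr_dem_in_Sym(2)[OF that]] by simp
  qed simp
  show ?thesis
    using assms(2) by (induction "is") (simp_all add: * foldr_dem_in_Sym assms(1))
qed

lemma ex_dem_left_word:
  assumes "w \<in> Sym N"
  shows "\<exists>is. set is \<subseteq> {1..<N} \<and> foldr dem_left is id = w"
  using assms
proof (induction w rule: Sym_induct_left)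
  case (ascent w i)
  then obtain "is" where "set is \<subseteq> {1..<N}" "foldr dem_left is id = w" by blast
  then have "set (i # is) \<subseteq> {1..<N}" "foldr dem_left (i # is) id = simple_refl i \<circ> w"
    using ascent.hyps by (simp_all add: dem_left_def)
  then show ?case by blast
next
  case id
  show "\<exists>is. set is \<subseteq> {1..<N} \<and> foldr dem_left is id = id"
    by (intro exI[of _ "[]"]) simp
qed

lemma ex_dem_right_word:
  assumes "w \<in> Sym N"
  shows "\<exists>is. set is \<subseteq> {1..<N} \<and> foldr dem_right is id = w"
  using assms
proof (induction w rule: Sym_induct)
  case (ascent w i)
  then obtain "is" where "set is \<subseteq> {1..<N}" "foldr dem_right is id = w" by blast
  then have "set (i # is) \<subseteq> {1..<N}" "foldr dem_right (i # is) id = w \<circ> simple_refl i"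
    using ascent.hyps by (simp_all add: dem_right_def)
  then show ?case by blast
next
  case id
  show "\<exists>is. set is \<subseteq> {1..<N} \<and> foldr dem_right is id = id"
    by (intro exI[of _ "[]"]) simp
qed

text \<open>The product \<open>f u v\<close> applies a word of left operators for \<open>u\<close>
  to \<open>v\<close>. As left and right operators commute, a word of right operators for
  \<open>v\<close> applied to \<open>u\<close> gives the same value. This makes the choice of words
  irrelevant and reduces associativity to one more commutation.\<close>

lemma ex_is_demazure: "\<exists>f. is_demazure N f"
proof -
  define lw where "lw = (\<lambda>u. SOME is. set is \<subseteq> {1..<N} \<and> foldr dem_left is id = u)"
  define rw where "rw = (\<lambda>u. SOME is. set is \<subseteq> {1..<N} \<and> foldr dem_right is id = u)"
  have lw: "set (lw u) \<subseteq> {1..<N}" "foldr dem_left (lw u) id = u" if "u \<in> Sym N" for u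
    using someI_ex[OF ex_dem_left_word[OF that]] by (simp_all add: lw_def)
  have rw: "set (rw u) \<subseteq> {1..<N}" "foldr dem_right (rw u) id = u" if "u \<in> Sym N" for u
    using someI_ex[OF ex_dem_right_word[OF that]] by (simp_all add: rw_def)
  define f where "f = restrict (\<lambda>u. restrict (\<lambda>v. foldr dem_left (lw u) v) (Sym N)) (Sym N)"
  have f_left: "f u v = foldr dem_left (lw u) v" if "u \<in> Sym N" "v \<in> Sym N" for u v
    using that by (simp add: f_def)
  have f_mixed: "foldr dem_left is v = foldr dem_right js u"
    if "set is \<subseteq> {1..<N}" "foldr dem_left is id = u" "set js \<subseteq> {1..<N}" "foldr dem_right js id = v"
    for u v "is" js
    using foldr_dem_commute[OF id_in_Sym that(1,3)] that by simp
  \<comment> \<open>Two left words for the same \<open>u\<close> agree on \<open>v\<close>, because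
    each agrees with one fixed right word for \<open>v\<close> acting on \<open>u\<close>.\<close>
  have f_leftI: "f u v = foldr dem_left is v"
    if "set is \<subseteq> {1..<N}" "foldr dem_left is id = u" "u \<in> Sym N" "v \<in> Sym N" for u v "is"
    using f_mixed[OF that(1,2) rw[OF that(4)]] f_mixed[OF lw[OF that(3)] rw[OF that(4)]]
    by (simp add: f_left that)
  have f_rightI: "f u v = foldr dem_right js u"
    if "set js \<subseteq> {1..<N}" "foldr dem_right js id = v" "u \<in> Sym N" "v \<in> Sym N" for u v js
    using f_mixed[OF lw[OF that(3)] that(1,2)] by (simp add: f_left that)
  have closed: "f u v \<in> Sym N" if "u \<in> Sym N" "v \<in> Sym N" for u v
    unfolding f_left[OF that] by (rule foldr_dem_in_Sym(1)[OF that(2) lw(1)[OF that(1)]])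
  have "is_demazure N f"
    unfolding is_demazure_def
  proof (intro conjI ballI)
    show "f \<in> Sym N \<rightarrow>\<^sub>E (Sym N \<rightarrow>\<^sub>E Sym N)"
      using closed by (auto simp: f_def PiE_iff extensional_def)
  next
    fix u v w assume *: "u \<in> Sym N" "v \<in> Sym N" "w \<in> Sym N"
    have "f (f u v) w = foldr dem_right (rw w) (foldr dem_left (lw u) v)"
      using f_rightI[OF rw[OF *(3)] closed[OF *(1,2)] *(3)] unfolding f_left[OF *(1,2)] .
    also have "\<dots> = foldr dem_left (lw u) (foldr dem_right (rw w) v)"
      by (rule foldr_dem_commute[OF *(2) lw(1)[OF *(1)] rw(1)[OF *(3)], symmetric])
    also have "\<dots> = f u (f v w)"
      using f_leftI[OF lw[OF *(1)] *(1) closed[OF *(2,3)]]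
      unfolding f_rightI[OF rw[OF *(3)] *(2,3)] by (rule sym)
    finally show "f (f u v) w = f u (f v w)" .
  next
    fix w assume w: "w \<in> Sym N"
    show "f id w = w" using f_leftI[of "[]" id w] w by simp
    show "f w id = w" using f_rightI[of "[]" id w] w by simp
  next
    fix i w assume i: "i \<in> {1..<N}" and w: "w \<in> Sym N"
    show "f (simple_refl i) w = (if cox_length N w < cox_length N (simple_refl i \<circ> w)
        then simple_refl i \<circ> w else w)"
      using f_leftI[of "[i]" "simple_refl i" w] w i
      by (simp add: cox_length_less_iff_left simple_refl_in_Sym dem_left_def)
    show "f w (simple_refl i) = (if cox_length N w < cox_length N (w \<circ> simple_refl i)
        then w \<circ> simple_refl i else w)"
      using f_rightI[of "[i]" "simple_refl i" w] w i
      by (simp add: cox_length_less_iff simple_refl_in_Sym dem_right_def)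
  qed
  then show ?thesis by blast
qed

text \<open>At an ascent, \<open>simple_refl i \<circ> u\<close> is itself a product of
  \<open>simple_refl i\<close> and \<open>u\<close> under both operations. Associativity moves the
  generator to the front, where its action is prescribed; the identity law is the base case.\<close>

lemma is_demazure_unique:
  assumes f: "is_demazure N f" and g: "is_demazure N g"
  shows "f = g"
proof -
  have *: "f u v = g u v" if "u \<in> Sym N" "v \<in> Sym N" for u v
    using that
  proof (induction u arbitrary: v rule: Sym_induct_left)
    case id
    then have "f id v = g id v" using f g unfolding is_demazure_def by simp
    then show ?case .
  next
    case (ascent u i)
    note i = simple_refl_in_Sym[OF ascent.hyps(2)]
    have step: "h (simple_refl i \<circ> u) v = h (simple_refl i) (h u v)" if h: "is_demazure N h" for h
    proof -
      have "simple_refl i \<circ> u = h (simple_refl i) u"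
        using h ascent.hyps cox_length_less_iff_left[OF ascent.hyps(1,2)]
        unfolding is_demazure_def by simp
      then show ?thesis using h i ascent.hyps ascent.prems unfolding is_demazure_def by metis
    qed
    have "g u v \<in> Sym N"
      using g ascent.hyps ascent.prems unfolding is_demazure_def PiE_iff by blast
    then show ?case
      using f g ascent.hyps(2) ascent.IH[OF ascent.prems] unfolding step[OF f] step[OF g]
      by (simp add: is_demazure_def)
  qed
  have ext: "f \<in> Sym N \<rightarrow>\<^sub>E (Sym N \<rightarrow>\<^sub>E Sym N)" "g \<in> Sym N \<rightarrow>\<^sub>E (Sym N \<rightarrow>\<^sub>E Sym N)"
    using f g by (auto simp: is_demazure_def)
  show ?thesis
  proof (rule PiE_ext[OF ext])
    fix u assume u: "u \<in> Sym N"
    show "f u = g u"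
      by (rule PiE_ext[OF PiE_mem[OF ext(1) u] PiE_mem[OF ext(2) u]]) (rule *[OF u])
  qed
qed

lemma is_demazure_demazure: "is_demazure N (demazure N)"
  unfolding demazure_def using ex_is_demazure is_demazure_unique by (metis theI)

lemma demazure_in_Sym: "u \<in> Sym N \<Longrightarrow> v \<in> Sym N \<Longrightarrow> demazure N u v \<in> Sym N"
  using is_demazure_demazure[of N] unfolding is_demazure_def PiE_iff by blast

lemma demazure_assoc:
  "u \<in> Sym N \<Longrightarrow> v \<in> Sym N \<Longrightarrow> w \<in> Sym N \<Longrightarrow>
    demazure N (demazure N u v) w = demazure N u (demazure N v w)"
  using is_demazure_demazure[of N] unfolding is_demazure_def by blast

lemma demazure_id:
  "w \<in> Sym N \<Longrightarrow> demazure N id w = w" "w \<in> Sym N \<Longrightarrow> demazure N w id = w"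
  using is_demazure_demazure[of N] unfolding is_demazure_def by blast+

lemma demazure_refl:
  assumes "w \<in> Sym N" "i \<in> {1..<N}"
  shows "demazure N (simple_refl i) w = dem_left i w" "demazure N w (simple_refl i) = dem_right i w"
  using is_demazure_demazure[of N] assms
  by (simp_all add: is_demazure_def cox_length_less_iff cox_length_less_iff_left dem_left_def
      dem_right_def)

section \<open>Demazure conjugation of fixed-point-free involutions\<close>

lemma w_fpf_apply:
  "w_fpf n m = (if m \<in> {1..2 * n} then if odd m then m + 1 else m - 1 else m)"
proof (induction n arbitrary: m)
  case 0
  then show ?case by (simp add: w_fpf_def)
next
  case (Suc n)
  have "w_fpf (Suc n) m = w_fpf n (simple_refl (2 * n + 1) m)"
    by (simp add: w_fpf_def word_perm_append)
  then show ?case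
    unfolding Suc simple_refl_apply by (auto elim: oddE evenE)
qed

lemma w_fpf_pos:
  assumes "k < n"
  shows "w_fpf n (2 * k + 1) = 2 * k + 2" "w_fpf n (2 * k + 2) = 2 * k + 1"
  using assms by (simp_all add: w_fpf_apply)

lemma pos_cases:
  fixes m :: nat
  assumes "m \<in> {1..2 * n}"
  obtains k where "k < n" "m = 2 * k + 1 \<or> m = 2 * k + 2"
proof -
  have "(m - 1) div 2 < n" "m = 2 * ((m - 1) div 2) + 1 \<or> m = 2 * ((m - 1) div 2) + 2"
    using assms by auto
  then show ?thesis using that by blast
qed

lemma fpf_involution_w_fpf: "fpf_involution n (w_fpf n)"
proof -
  have "w_fpf n \<in> Sym (2 * n)"
    unfolding w_fpf_def by (rule word_perm_in_Sym) auto
  moreover have "w_fpf n (w_fpf n m) = m" for m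
  proof (cases "m \<in> {1..2 * n}")
    case True
    then obtain k where k: "k < n" and "m = 2 * k + 1 \<or> m = 2 * k + 2" by (rule pos_cases)
    then show ?thesis using w_fpf_pos[OF k] by metis
  qed (auto simp: w_fpf_apply)
  ultimately show ?thesis
    unfolding fpf_involution_def by (auto simp: fun_eq_iff w_fpf_apply)
qed

lemma fpf_involutionD:
  assumes "fpf_involution n y"
  shows "y \<in> Sym (2 * n)" "y (y m) = m" "inv y = y" "m \<in> {1..2 * n} \<Longrightarrow> y m \<noteq> m"
proof -
  show "y \<in> Sym (2 * n)" "m \<in> {1..2 * n} \<Longrightarrow> y m \<noteq> m"
    using assms by (simp_all add: fpf_involution_def)
  have "y \<circ> y = id" using assms by (simp add: fpf_involution_def)
  then show "y (y m) = m" "inv y = y"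
    by (simp_all add: fun_eq_iff inv_unique_comp)
qed

lemma fpf_involution_conj:
  assumes y: "fpf_involution n y" and i: "i \<in> {1..<2 * n}"
  shows "fpf_involution n (simple_refl i \<circ> y \<circ> simple_refl i)"
  unfolding fpf_involution_def
proof (intro conjI ballI)
  note D = fpf_involutionD[OF y] and s = simple_refl_in_Sym[OF i]
  show "simple_refl i \<circ> y \<circ> simple_refl i \<in> Sym (2 * n)"
    by (intro comp_in_Sym s D(1))
  show "(simple_refl i \<circ> y \<circ> simple_refl i) \<circ> (simple_refl i \<circ> y \<circ> simple_refl i) = id"
    by (simp add: fun_eq_iff D(2))
  fix m assume "m \<in> {1..2 * n}"
  then have "y (simple_refl i m) \<noteq> simple_refl i m"
    using Sym_in_range[OF s, of m] D(4) by blast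
  then show "(simple_refl i \<circ> y \<circ> simple_refl i) m \<noteq> m"
    by (metis comp_apply simple_refl_invol)
qed

text \<open>\<open>simple_refl i\<close> reverses an increasing pair of values only if it is
  \<open>(i, i + 1)\<close>, which here would make \<open>i\<close> a fixed point of
  \<open>y\<close>.\<close>

lemma fpf_refl_less:
  assumes y: "fpf_involution n y" and i: "i \<in> {1..<2 * n}" and less: "y i < y (i + 1)"
  shows "simple_refl i (y i) < simple_refl i (y (i + 1))"
  using less fpf_involutionD(4)[OF y, of i] i by (auto simp: simple_refl_less_iff)

lemma demazure_conj_refl:
  assumes y: "fpf_involution n y" and i: "i \<in> {1..<2 * n}"
  shows "demazure (2 * n) (demazure (2 * n) (simple_refl i) y) (simple_refl i) =
    (if y i < y (i + 1) then simple_refl i \<circ> y \<circ> simple_refl i else y)"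
  using fpf_involutionD(1,3)[OF y] fpf_refl_less[OF y i]
  by (simp add: demazure_refl[OF _ i] dem_in_Sym[OF _ i]) (simp add: dem_left_def dem_right_def)

lemma inv_num_conj:
  assumes y: "fpf_involution n y" and i: "i \<in> {1..<2 * n}" and less: "y i < y (i + 1)"
  shows "inv_num (simple_refl i \<circ> y \<circ> simple_refl i) = inv_num y + 2"
proof -
  note Y = fpf_involutionD(1,3)[OF y]
  have sy: "simple_refl i \<circ> y \<in> Sym (2 * n)" by (intro comp_in_Sym simple_refl_in_Sym i Y)
  have "inv_num (simple_refl i \<circ> y) = inv_num y + 1"
    using inv_num_ascent_left[OF Y(1) i] less Y(2) by simp
  moreover have "inv_num (simple_refl i \<circ> y \<circ> simple_refl i) = inv_num (simple_refl i \<circ> y) + 1"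
    by (rule inv_num_ascent[OF sy]) (use fpf_refl_less[OF y i less] in simp)
  ultimately show ?thesis by simp
qed

section \<open>Demazure conjugates of \<open>w_fpf n\<close> and the order of their arcs\<close>

definition dem_conj :: "nat \<Rightarrow> (nat \<Rightarrow> nat) \<Rightarrow> (nat \<Rightarrow> nat)" where
  "dem_conj n w = demazure (2 * n) (demazure (2 * n) (inv w) (w_fpf n)) w"

lemma dem_conj_id: "dem_conj n id = w_fpf n"
  using fpf_involutionD(1)[OF fpf_involution_w_fpf] by (simp add: dem_conj_def demazure_id)

text \<open>At an ascent the new letter is a Demazure factor on the right of \<open>w\<close> and on
  the left of \<open>inv w\<close>. Associativity moves both copies outside, where they conjugate
  \<open>dem_conj n w\<close>.\<close>

lemma dem_conj_ascent:
  assumes w: "w \<in> Sym (2 * n)" and i: "i \<in> {1..<2 * n}" and less: "w i < w (i + 1)"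
    and fpf: "fpf_involution n (dem_conj n w)"
  shows "dem_conj n (w \<circ> simple_refl i) =
    (if dem_conj n w i < dem_conj n w (i + 1)
     then simple_refl i \<circ> dem_conj n w \<circ> simple_refl i else dem_conj n w)"
proof -
  let ?N = "2 * n" and ?s = "simple_refl i" and ?d = "demazure (2 * n)" and ?x = "w_fpf n"
  note S = w simple_refl_in_Sym[OF i] inv_in_Sym[OF w] fpf_involutionD(1)[OF fpf_involution_w_fpf, of n]
  have "w \<circ> ?s = ?d w ?s" using less by (simp add: demazure_refl[OF w i] dem_right_def)
  moreover have "inv (w \<circ> ?s) = ?d ?s (inv w)"
    using less
    by (simp add: demazure_refl[OF S(3) i] dem_left_def inv_comp_refl_Sym[OF w] inv_inv_Sym[OF w])
  ultimately have "dem_conj n (w \<circ> ?s) = ?d (?d (?d ?s (inv w)) ?x) (?d w ?s)"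
    by (simp only: dem_conj_def)
  also have "\<dots> = ?d (?d ?s (dem_conj n w)) ?s"
    using S by (simp add: dem_conj_def demazure_assoc demazure_in_Sym)
  finally show ?thesis by (simp add: demazure_conj_refl[OF fpf i])
qed

text \<open>The ordinary conjugate, whose 2-cycles are the blocks
  \<open>{u (2 * k + 1), u (2 * k + 2)}\<close> of the one-line form of \<open>u\<close>.\<close>

definition arc_perm :: "nat \<Rightarrow> (nat \<Rightarrow> nat) \<Rightarrow> (nat \<Rightarrow> nat)" where
  "arc_perm n u = u \<circ> w_fpf n \<circ> inv u"

text \<open>The arcs \<open>{u(2k + 1), u(2k + 2)}\<close> are written in increasing order and listed along a linear
  extension of the componentwise order.\<close>

definition arcs_sorted :: "nat \<Rightarrow> (nat \<Rightarrow> nat) \<Rightarrow> bool" where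
  "arcs_sorted n u \<longleftrightarrow>
     (\<forall>k<n. u (2 * k + 1) < u (2 * k + 2)) \<and>
     (\<forall>k<n. \<forall>j<k. u (2 * j + 1) < u (2 * k + 1) \<or> u (2 * j + 2) < u (2 * k + 2))"

text \<open>Only the mutual order of the values \<open>i\<close> and \<open>i + 1\<close> changes.
  If both are left ends or both are right ends of their arcs, that comparison is lost, and the
  opposite ends, which are the partners, have to supply it. If \<open>i\<close> is a right end and
  \<open>i + 1\<close> a left end, the partners lie outside and are in order. In the remaining cases
  both sides of the equivalence fail.\<close>

lemma arcs_sorted_refl_iff:
  assumes u: "u \<in> Sym (2 * n)" and i: "i \<in> {1..<2 * n}" and less: "inv u i < inv u (i + 1)"
  shows "arcs_sorted n (simple_refl i \<circ> u) \<longleftrightarrow>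
    arcs_sorted n u \<and> arc_perm n u i < arc_perm n u (i + 1)"
proof -
  let ?s = "simple_refl i"
  define p where "p = inv u i"
  define q where "q = inv u (i + 1)"
  have pq: "p < q" "u p = i" "u q = i + 1"
    using less by (simp_all add: p_def q_def Sym_inv_apply[OF u])
  have upos: "m = p" if "u m = i" for m using that pq Sym_eq_iff[OF u] by metis
  have uqos: "m = q" if "u m = i + 1" for m using that pq Sym_eq_iff[OF u] by metis
  \<comment> \<open>Passing from \<open>u\<close> to \<open>?s \<circ> u\<close> only creates the
    inversion at positions \<open>p\<close> and \<open>q\<close>: \<open>down\<close> transfers
    comparisons back to \<open>u\<close>, and \<open>up\<close> transfers all others
    forward.\<close>
  have down: "u a < u b" if "?s (u a) < ?s (u b)" "a < b" for a b
    using that(1) upos[of b] uqos[of a] that(2) pq(1) unfolding simple_refl_less_iff by auto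
  have up: "?s (u a) < ?s (u b)" if "u a < u b" "\<not> (a = p \<and> b = q)" for a b
    using that upos[of a] uqos[of b] unfolding simple_refl_less_iff by auto
  have arc: "arc_perm n u i = u (w_fpf n p)" "arc_perm n u (i + 1) = u (w_fpf n q)"
    by (simp_all add: arc_perm_def p_def q_def)
  have "p \<in> {1..2 * n}" "q \<in> {1..2 * n}"
    using i Sym_in_range[OF u, of p] Sym_in_range[OF u, of q] pq by auto
  then obtain j k where j: "j < n" "p = 2 * j + 1 \<or> p = 2 * j + 2"
    and k: "k < n" "q = 2 * k + 1 \<or> q = 2 * k + 2"
    by (meson pos_cases)
  have "j \<le> k" using j(2) k(2) pq(1) by linarith
  note wj = w_fpf_pos[OF j(1)] and wk = w_fpf_pos[OF k(1)]
  show ?thesis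
  proof
    assume lhs: "arcs_sorted n (?s \<circ> u)"
    have ord: "?s (u (2 * l + 1)) < ?s (u (2 * l + 2))" if "l < n" for l
      using lhs that by (simp add: arcs_sorted_def)
    have ext: "?s (u (2 * a + 1)) < ?s (u (2 * b + 1)) \<or> ?s (u (2 * a + 2)) < ?s (u (2 * b + 2))"
      if "a < b" "b < n" for a b
      using lhs that by (simp add: arcs_sorted_def)
    have ord_u: "u (2 * l + 1) < u (2 * l + 2)" if "l < n" for l
      using down[OF ord[OF that]] by simp
    have "u (2 * a + 1) < u (2 * b + 1) \<or> u (2 * a + 2) < u (2 * b + 2)" if "a < b" "b < n" for a b
      using ext[OF that] down[of "2 * a + 1" "2 * b + 1"] down[of "2 * a + 2" "2 * b + 2"] that(1)
      by linarith
    with ord_u have "arcs_sorted n u" by (simp add: arcs_sorted_def)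
    moreover have "u (w_fpf n p) < u (w_fpf n q)"
    proof -
      have sp: "?s (u p) = i + 1" "?s (u q) = i" using pq by (simp_all add: simple_refl_apply)
      have "j \<noteq> k"
      proof
        assume "j = k"
        then have "p = 2 * j + 1" "q = 2 * j + 2" using j(2) k(2) pq(1) by linarith+
        then show False using ord[OF j(1)] sp by simp
      qed
      with \<open>j \<le> k\<close> have "j < k" by simp
      note e = ext[OF this k(1)]
      have d: "u (2 * j + 1) < u (2 * k + 1)" if "?s (u (2 * j + 1)) < ?s (u (2 * k + 1))"
        using down[OF that] \<open>j < k\<close> by simp
      have d': "u (2 * j + 2) < u (2 * k + 2)" if "?s (u (2 * j + 2)) < ?s (u (2 * k + 2))"
        using down[OF that] \<open>j < k\<close> by simp
      from j(2) k(2) show ?thesis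
      proof (elim disjE)
        assume h: "p = 2 * j + 1" "q = 2 * k + 1"
        then show ?thesis using e sp d' wj wk by simp
      next
        assume h: "p = 2 * j + 2" "q = 2 * k + 2"
        then show ?thesis using e sp d wj wk by simp
      next
        \<comment> \<open>The partner of \<open>i\<close> lies below \<open>i\<close> and that of
          \<open>i + 1\<close> above \<open>i + 1\<close>, so the order inside the blocks
          suffices.\<close>
        assume h: "p = 2 * j + 2" "q = 2 * k + 1"
        then show ?thesis using ord_u[OF j(1)] ord_u[OF k(1)] pq wj wk by simp
      next
        \<comment> \<open>Impossible: after the exchange block \<open>j\<close> lies in values from
          \<open>i + 1\<close> upwards and block \<open>k\<close> in values up to \<open>i\<close>,
          so both alternatives in \<open>e\<close> fail.\<close>
        assume h: "p = 2 * j + 1" "q = 2 * k + 2"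
        then show ?thesis using e sp ord[OF j(1)] ord[OF k(1)] by simp
      qed
    qed
    ultimately show "arcs_sorted n u \<and> arc_perm n u i < arc_perm n u (i + 1)"
      unfolding arc by blast
  next
    assume rhs: "arcs_sorted n u \<and> arc_perm n u i < arc_perm n u (i + 1)"
    then have asc: "u (w_fpf n p) < u (w_fpf n q)" unfolding arc by blast
    have ord: "u (2 * l + 1) < u (2 * l + 2)" if "l < n" for l
      using rhs that by (simp add: arcs_sorted_def)
    have ext: "u (2 * a + 1) < u (2 * b + 1) \<or> u (2 * a + 2) < u (2 * b + 2)"
      if "a < b" "b < n" for a b
      using rhs that by (simp add: arcs_sorted_def)
    have "?s (u (2 * l + 1)) < ?s (u (2 * l + 2))" if "l < n" for l
    proof (rule up[OF ord[OF that]])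
      \<comment> \<open>In a common block \<open>i\<close> and \<open>i + 1\<close> would be
        partners, and \<open>asc\<close> would read \<open>i + 1 < i\<close>.\<close>
      show "\<not> (2 * l + 1 = p \<and> 2 * l + 2 = q)"
        using asc pq w_fpf_pos[OF that] by auto
    qed
    moreover have "?s (u (2 * a + 1)) < ?s (u (2 * b + 1)) \<or> ?s (u (2 * a + 2)) < ?s (u (2 * b + 2))"
      if "a < b" "b < n" for a b
    proof -
      have an: "a < n" using that by simp
      note wa = w_fpf_pos[OF an] and wb = w_fpf_pos[OF that(2)]
      consider "2 * a + 1 = p" "2 * b + 1 = q" | "2 * a + 2 = p" "2 * b + 2 = q"
        | "\<not> (2 * a + 1 = p \<and> 2 * b + 1 = q)" "\<not> (2 * a + 2 = p \<and> 2 * b + 2 = q)" by blast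
      then show ?thesis
      proof cases
        case 1
        then have "u (2 * a + 2) < u (2 * b + 2)" using asc wa wb by auto
        then show ?thesis using up[of "2 * a + 2" "2 * b + 2"] 1 by auto
      next
        case 2
        then have "u (2 * a + 1) < u (2 * b + 1)" using asc wa wb by auto
        then show ?thesis using up[of "2 * a + 1" "2 * b + 1"] 2 by auto
      next
        case 3
        then show ?thesis using ext[OF that] up by blast
      qed
    qed
    ultimately show "arcs_sorted n (?s \<circ> u)" by (simp add: arcs_sorted_def)
  qed
qed

lemma arc_perm_refl:
  assumes "u \<in> Sym N"
  shows "arc_perm n (simple_refl i \<circ> u) = simple_refl i \<circ> arc_perm n u \<circ> simple_refl i"
  by (simp add: arc_perm_def inv_comp_refl_Sym[OF assms] o_assoc)

text \<open>Each step along a word of \<open>w\<close> raises the number of inversions of \<open>dem_conj n w\<close> by at most 2,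
  and it preserves \<open>arcs_sorted\<close> exactly when the increase is 2.\<close>

lemma dem_conj_properties:
  assumes "w \<in> Sym (2 * n)"
  shows "fpf_involution n (dem_conj n w) \<and>
    inv_num (dem_conj n w) \<le> inv_num (w_fpf n) + 2 * inv_num w \<and>
    (inv_num (dem_conj n w) = inv_num (w_fpf n) + 2 * inv_num w \<longleftrightarrow> arcs_sorted n (inv w)) \<and>
    (arcs_sorted n (inv w) \<longrightarrow> dem_conj n w = arc_perm n (inv w))" (is "?P w")
  using assms
proof (induction w rule: Sym_induct)
  case id
  have "arcs_sorted n id" by (simp add: arcs_sorted_def)
  moreover have "arc_perm n id = w_fpf n" by (simp add: arc_perm_def)
  ultimately have "?P id"
    unfolding dem_conj_id inv_id inv_num_id using fpf_involution_w_fpf by (simp del: id_apply)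
  then show ?case .
next
  case (ascent w i)
  let ?s = "simple_refl i"
  define u where "u = inv w"
  define y where "y = dem_conj n w"
  have IH: "fpf_involution n y" "inv_num y \<le> inv_num (w_fpf n) + 2 * inv_num w"
    "inv_num y = inv_num (w_fpf n) + 2 * inv_num w \<longleftrightarrow> arcs_sorted n u"
    "arcs_sorted n u \<Longrightarrow> y = arc_perm n u"
    using ascent.IH by (simp_all add: u_def y_def)
  have u: "u \<in> Sym (2 * n)" "inv u = w"
    using ascent.hyps(1) by (simp_all add: u_def inv_in_Sym inv_inv_Sym)
  have invw: "inv (w \<circ> ?s) = ?s \<circ> u"
    by (simp add: u_def inv_comp_refl_Sym[OF ascent.hyps(1)])
  have len: "inv_num (w \<circ> ?s) = inv_num w + 1"
    by (rule inv_num_ascent[OF ascent.hyps(1,3)])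
  have D: "dem_conj n (w \<circ> ?s) = (if y i < y (i + 1) then ?s \<circ> y \<circ> ?s else y)"
    using dem_conj_ascent[OF ascent.hyps] IH(1) by (simp add: y_def)
  \<comment> \<open>\<open>arcs_sorted_refl_iff\<close> speaks of \<open>arc_perm n u\<close>, which
    is known to equal \<open>y\<close> only when \<open>arcs_sorted n u\<close> holds; otherwise
    both sides are false.\<close>
  have iff: "arcs_sorted n (?s \<circ> u) \<longleftrightarrow> arcs_sorted n u \<and> y i < y (i + 1)"
    using arcs_sorted_refl_iff[OF u(1) ascent.hyps(2)] ascent.hyps(3) IH(4) by (auto simp: u(2))
  have "?P (w \<circ> ?s)"
  proof (cases "y i < y (i + 1)")
    case True
    then show ?thesis
      unfolding invw len iff arc_perm_refl[OF u(1)]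
      using IH D inv_num_conj[OF IH(1) ascent.hyps(2) True] fpf_involution_conj[OF IH(1) ascent.hyps(2)]
      by (auto simp del: comp_apply)
  next
    case False
    then show ?thesis
      unfolding invw len iff using IH D by (auto simp del: comp_apply)
  qed
  then show ?case .
qed

section \<open>Orderings of the arcs\<close>

lemma flatten_pairs_simps [simp]:
  "flatten_pairs [] = []"
  "flatten_pairs (p # ps) = int (fst p) # int (snd p) # flatten_pairs ps"
  "flatten_pairs (ps @ qs) = flatten_pairs ps @ flatten_pairs qs"
  by (simp_all add: flatten_pairs_def split: prod.split)

lemma length_flatten_pairs [simp]: "length (flatten_pairs ps) = 2 * length ps"
  by (induction ps) simp_all

lemma flatten_pairs_eq_iff: "flatten_pairs ps = flatten_pairs qs \<longleftrightarrow> ps = qs"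
proof
  show "ps = qs" if "flatten_pairs ps = flatten_pairs qs"
    using that
  proof (induction ps arbitrary: qs)
    case Nil
    then show ?case by (cases qs) simp_all
  next
    case (Cons p ps)
    then show ?case by (cases qs) (simp_all add: prod_eq_iff)
  qed
qed simp

text \<open>The even prefix makes the four entries fall into two whole pairs instead of cutting
  across three.\<close>

lemma flatten_pairs_split:
  assumes "flatten_pairs ps = us @ [a, b, c, d] @ vs" "even (length us)"
  obtains xs p q ys where "ps = xs @ [p, q] @ ys" "us = flatten_pairs xs" "vs = flatten_pairs ys"
    "a = int (fst p)" "b = int (snd p)" "c = int (fst q)" "d = int (snd q)"
proof -
  have "\<exists>xs p q ys. ps = xs @ [p, q] @ ys \<and> us = flatten_pairs xs \<and> vs = flatten_pairs ys \<and>
    a = int (fst p) \<and> b = int (snd p) \<and> c = int (fst q) \<and> d = int (snd q)"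
    using assms
  proof (induction ps arbitrary: us)
    case Nil
    then show ?case by simp
  next
    case (Cons p ps)
    show ?case
    proof (cases us)
      case Nil
      then obtain q ys where "ps = q # ys" using Cons.prems by (cases ps) simp_all
      then show ?thesis using Cons.prems Nil by (intro exI[of _ "[]"]) simp
    next
      case us: (Cons u1 us1)
      then obtain u2 us2 where us1: "us1 = u2 # us2" using Cons.prems by (cases us1) simp_all
      have "flatten_pairs ps = us2 @ [a, b, c, d] @ vs" "even (length us2)"
        using Cons.prems us us1 by simp_all
      from Cons.IH[OF this] obtain xs p' q ys where *: "ps = xs @ [p', q] @ ys"
        "us2 = flatten_pairs xs" "vs = flatten_pairs ys"
        "a = int (fst p')" "b = int (snd p')" "c = int (fst q)" "d = int (snd q)" by blast
      have "p # ps = (p # xs) @ [p', q] @ ys" "us = flatten_pairs (p # xs)"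
        using Cons.prems us us1 * by simp_all
      with * show ?thesis by blast
    qed
  qed
  then show ?thesis using that by blast
qed

definition arc_list :: "nat \<Rightarrow> (nat \<Rightarrow> nat) \<Rightarrow> (nat \<times> nat) list" where
  "arc_list n u = map (\<lambda>k. (u (2 * k + 1), u (2 * k + 2))) [0..<n]"

lemma flatten_arc_list: "flatten_pairs (arc_list n u) = one_line (2 * n) u"
proof (induction n)
  case 0
  then show ?case by (simp add: arc_list_def one_line_def)
next
  case (Suc n)
  have "one_line (2 * Suc n) u = one_line (2 * n) u @ [int (u (2 * n + 1)), int (u (2 * n + 2))]"
    by (simp add: one_line_def)
  then show ?case using Suc by (simp add: arc_list_def)
qed

text \<open>Distinct arcs of a fixed-point-free involution share no endpoint, so the disjunction
  says precisely that the later arc is not below the earlier one in both coordinates.\<close>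

definition arc_extension :: "nat \<Rightarrow> (nat \<Rightarrow> nat) \<Rightarrow> (nat \<times> nat) list \<Rightarrow> bool" where
  "arc_extension n x ps \<longleftrightarrow> distinct ps \<and> set ps = cycle_pairs n x \<and>
     sorted_wrt (\<lambda>p q. fst p < fst q \<or> snd p < snd q) ps"

lemma cycle_pairsD:
  assumes "fpf_involution n x" "p \<in> cycle_pairs n x"
  shows "fst p < snd p" "x (fst p) = snd p" "x (snd p) = fst p" "fst p \<in> {1..2 * n}" "snd p \<in> {1..2 * n}"
  using assms(2) fpf_involutionD(2)[OF assms(1)] by (auto simp: cycle_pairs_def)

text \<open>The link between the two halves: the left side is the form on which
  \<open>fpf_step\<close> acts, the right side the one that comes out of counting
  inversions.\<close>

lemma arc_extension_arc_list_iff: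
  assumes x: "fpf_involution n x" and u: "u \<in> Sym (2 * n)"
  shows "arc_extension n x (arc_list n u) \<longleftrightarrow> arcs_sorted n u \<and> arc_perm n u = x"
proof
  assume ext: "arc_extension n x (arc_list n u)"
  have arc: "(u (2 * k + 1), u (2 * k + 2)) \<in> cycle_pairs n x" if "k < n" for k
    using ext that by (auto simp: arc_extension_def arc_list_def)
  have "arcs_sorted n u"
    using ext cycle_pairsD(1)[OF x arc]
    by (auto simp: arcs_sorted_def arc_extension_def arc_list_def sorted_wrt_iff_nth_less)
  moreover have "x (u m) = u (w_fpf n m)" for m
  proof (cases "m \<in> {1..2 * n}")
    case True
    then obtain k where k: "k < n" and m: "m = 2 * k + 1 \<or> m = 2 * k + 2" by (rule pos_cases)
    then show ?thesis using cycle_pairsD(2,3)[OF x arc[OF k]] w_fpf_pos[OF k] by auto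
  next
    case False
    then have "w_fpf n m = m" "u m = m" "x m = m"
      using Sym_outside[OF u] Sym_outside[OF fpf_involutionD(1)[OF x]] by (simp_all only: w_fpf_apply if_False)
    then show ?thesis by simp
  qed
  from this[of "inv u _"] have "arc_perm n u = x"
    by (simp add: arc_perm_def fun_eq_iff Sym_inv_apply[OF u])
  ultimately show "arcs_sorted n u \<and> arc_perm n u = x" ..
next
  assume *: "arcs_sorted n u \<and> arc_perm n u = x"
  have xu: "x (u m) = u (w_fpf n m)" for m
    using * by (auto simp: arc_perm_def Sym_inv_apply[OF u])
  have range: "u (2 * k + 1) \<in> {1..2 * n}" "u (2 * k + 2) \<in> {1..2 * n}" if "k < n" for k
    using that Sym_in_range[OF u, of "2 * k + 1"] Sym_in_range[OF u, of "2 * k + 2"] by auto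
  have "set (arc_list n u) = cycle_pairs n x"
  proof (intro equalityI subsetI)
    fix p assume "p \<in> set (arc_list n u)"
    then obtain k where k: "k < n" "p = (u (2 * k + 1), u (2 * k + 2))"
      by (auto simp: arc_list_def)
    then show "p \<in> cycle_pairs n x"
      using * range[OF k(1)] xu[of "2 * k + 1"] w_fpf_pos[OF k(1)]
      by (simp add: cycle_pairs_def arcs_sorted_def)
  next
    fix p assume "p \<in> cycle_pairs n x"
    then obtain a b where p: "p = (a, b)" "a \<in> {1..2 * n}" "a < b" "b = x a"
      by (auto simp: cycle_pairs_def)
    define m where "m = inv u a"
    have a: "a = u m" by (simp add: m_def Sym_inv_apply[OF u])
    then have "m \<in> {1..2 * n}" using p(2) Sym_in_range[OF u, of m] by simp
    then obtain k where k: "k < n" and m: "m = 2 * k + 1 \<or> m = 2 * k + 2" by (rule pos_cases)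
    have b: "b = u (w_fpf n m)" using xu[of m] p a by simp
    from m show "p \<in> set (arc_list n u)"
    proof
      assume "m = 2 * k + 1"
      then have "p = (u (2 * k + 1), u (2 * k + 2))" using p a b w_fpf_pos[OF k] by simp
      with k show ?thesis by (auto simp: arc_list_def)
    next
      \<comment> \<open>\<open>a\<close> is the smaller end of its arc, so it cannot occupy the
        second place of a block.\<close>
      assume "m = 2 * k + 2"
      then have "u (2 * k + 2) < u (2 * k + 1)" using p a b w_fpf_pos[OF k] by simp
      moreover have "u (2 * k + 1) < u (2 * k + 2)" using * k by (simp add: arcs_sorted_def)
      ultimately show ?thesis by simp
    qed
  qed
  moreover have "distinct (arc_list n u)"
    unfolding arc_list_def distinct_map by (auto intro!: inj_onI simp: Sym_eq_iff[OF u])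
  ultimately show "arc_extension n x (arc_list n u)"
    using * by (auto simp: arcs_sorted_def arc_extension_def arc_list_def sorted_wrt_iff_nth_less)
qed

lemma distinct_flatten_pairs:
  assumes x: "fpf_involution n x" and "distinct ps" "set ps \<subseteq> cycle_pairs n x"
  shows "distinct (flatten_pairs ps) \<and>
    set (flatten_pairs ps) = int ` fst ` set ps \<union> int ` snd ` set ps"
  using assms(2,3)
proof (induction ps)
  case (Cons p ps)
  have p: "p \<in> cycle_pairs n x" using Cons.prems by simp
  have "int (fst p) \<noteq> int (fst q) \<and> int (fst p) \<noteq> int (snd q) \<and>
      int (snd p) \<noteq> int (fst q) \<and> int (snd p) \<noteq> int (snd q)" if "q \<in> set ps" for q
  proof -
    have q: "q \<in> cycle_pairs n x" "q \<noteq> p" using that Cons.prems by auto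
    then show ?thesis
      using cycle_pairsD[OF x p] cycle_pairsD[OF x q(1)]
      by (metis nat_int not_less_iff_gr_or_eq prod_eq_iff)
  qed
  then show ?case
    using Cons cycle_pairsD(1)[OF x p] by auto
qed simp

lemma fst_snd_cycle_pairs:
  assumes x: "fpf_involution n x"
  shows "fst ` cycle_pairs n x \<union> snd ` cycle_pairs n x = {1..2 * n}"
proof (intro equalityI subsetI)
  fix m assume "m \<in> fst ` cycle_pairs n x \<union> snd ` cycle_pairs n x"
  then show "m \<in> {1..2 * n}" using cycle_pairsD(4,5)[OF x] by auto
next
  fix m assume m: "m \<in> {1..2 * n}"
  have xm: "x m \<in> {1..2 * n}" using Sym_in_range[OF fpf_involutionD(1)[OF x]] m by blast
  show "m \<in> fst ` cycle_pairs n x \<union> snd ` cycle_pairs n x"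
  proof (cases "m < x m")
    case True
    then have "(m, x m) \<in> cycle_pairs n x" using m xm by (simp add: cycle_pairs_def)
    then show ?thesis by force
  next
    case False
    then have "x m < m" using fpf_involutionD(4)[OF x m] by simp
    then have "(x m, m) \<in> cycle_pairs n x"
      using m xm fpf_involutionD(2)[OF x, of m] by (simp add: cycle_pairs_def)
    then show ?thesis by force
  qed
qed

lemma ex_one_line:
  assumes "distinct l" "set l = int ` {1..N}"
  shows "\<exists>u\<in>Sym N. one_line N u = l"
proof -
  have len: "length l = N"
    using distinct_card[OF assms(1)] assms(2) by (simp add: card_image)
  \<comment> \<open>Positions count from 1 and list indices from 0, hence \<open>m - 1\<close>; the
    value \<open>m\<close> elsewhere makes \<open>u\<close> the identity outside
    \<open>{1..N}\<close>.\<close>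
  define u where "u = (\<lambda>m. if m \<in> {1..N} then nat (l ! (m - 1)) else m)"
  have mem: "l ! k \<in> int ` {1..N}" if "k < N" for k
    using that len assms(2) nth_mem by metis
  have "inj_on u {1..N}"
  proof (rule inj_onI)
    fix a b assume ab: "a \<in> {1..N}" "b \<in> {1..N}" "u a = u b"
    then have "nat (l ! (a - 1)) = nat (l ! (b - 1))" by (simp add: u_def)
    moreover have "a - 1 < N" "b - 1 < N" using ab by auto
    then have "l ! (a - 1) \<ge> 0" "l ! (b - 1) \<ge> 0" using mem by fastforce+
    ultimately have "l ! (a - 1) = l ! (b - 1)" by simp
    then have "a - 1 = b - 1"
      using nth_eq_iff_index_eq[OF assms(1), of "a - 1" "b - 1"] ab len by auto
    then show "a = b" using ab by auto
  qed
  moreover have sub: "u ` {1..N} \<subseteq> {1..N}"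
  proof (rule image_subsetI)
    fix a assume a: "a \<in> {1..N}"
    then have "l ! (a - 1) \<in> int ` {1..N}" by (intro mem) auto
    then show "u a \<in> {1..N}" using a by (auto simp: u_def)
  qed
  ultimately have "bij_betw u {1..N} {1..N}"
    unfolding bij_betw_def using endo_inj_surj by blast
  then have "u permutes {1..N}"
    by (rule bij_imp_permutes) (auto simp: u_def)
  moreover have "one_line N u = l"
  proof (rule nth_equalityI)
    fix k assume "k < length (one_line N u)"
    then have "k < N" by (simp add: one_line_def del: upt_Suc)
    then show "one_line N u ! k = l ! k"
      using mem[of k] by (auto simp: one_line_def u_def nth_upt simp del: upt_Suc)
  qed (simp add: one_line_def len del: upt_Suc)
  ultimately show ?thesis by (auto simp: Sym_def)
qed

lemma ex_arc_list:
  assumes x: "fpf_involution n x" and ext: "arc_extension n x ps"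
  shows "\<exists>u\<in>Sym (2 * n). arc_list n u = ps"
proof -
  have ps: "distinct ps" "set ps = cycle_pairs n x" using ext by (simp_all add: arc_extension_def)
  then have "distinct (flatten_pairs ps)"
    "set (flatten_pairs ps) = int ` (fst ` cycle_pairs n x \<union> snd ` cycle_pairs n x)"
    using distinct_flatten_pairs[OF x, of ps] by (simp_all add: image_Un)
  then obtain u where "u \<in> Sym (2 * n)" "one_line (2 * n) u = flatten_pairs ps"
    unfolding fst_snd_cycle_pairs[OF x] using ex_one_line by blast
  then show ?thesis by (auto simp: flatten_pairs_eq_iff simp flip: flatten_arc_list)
qed

section \<open>Exchanges of neighbouring nested arcs\<close>

lemma length_arc_extension:
  assumes "fpf_involution n x" and "arc_extension n x ps"
  shows "length ps = n"
  using ex_arc_list[OF assms] by (auto simp: arc_list_def)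

text \<open>For nested arcs one order is justified by the left ends and the other by the right ends;
  all other comparisons are the same on both sides.\<close>

lemma arc_extension_swap_iff:
  assumes "fst p < fst q" "snd q < snd p"
  shows "arc_extension n x (xs @ [p, q] @ ys) \<longleftrightarrow> arc_extension n x (xs @ [q, p] @ ys)"
proof -
  have "set (xs @ [p, q] @ ys) = set (xs @ [q, p] @ ys)" by auto
  then show ?thesis
    unfolding arc_extension_def using assms by (auto simp: sorted_wrt_append)
qed

text \<open>\<open>fpf_step\<close> supplies weak inequalities only. They are strict because
  \<open>x\<close> determines an arc from either of its endpoints.\<close>

lemma nested_arcs:
  assumes x: "fpf_involution n x" and ext: "arc_extension n x ps"
    and pq: "p \<in> set ps" "q \<in> set ps" "p \<noteq> q" and le: "fst p \<le> fst q" "snd q \<le> snd p"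
  shows "fst p < fst q" "snd q < snd p"
proof -
  have "p \<in> cycle_pairs n x" "q \<in> cycle_pairs n x" using ext pq by (simp_all add: arc_extension_def)
  note D = cycle_pairsD(2,3)[OF x this(1)] cycle_pairsD(2,3)[OF x this(2)]
  have "fst p \<noteq> fst q" "snd p \<noteq> snd q" using D pq(3) by (metis prod_eqI)+
  with le show "fst p < fst q" "snd q < snd p" by simp_all
qed

lemma fpf_step_arc_extension:
  assumes x: "fpf_involution n x" and ext: "arc_extension n x ps" and step: "fpf_step n (flatten_pairs ps) l"
  shows "\<exists>qs. l = flatten_pairs qs \<and> arc_extension n x qs"
proof -
  obtain us vs a b c d where ev: "even (length us)" and le: "a \<le> b" "b \<le> c" "c \<le> d"
    and eq: "flatten_pairs ps = us @ [a, d, b, c] @ vs" "l = us @ [b, c, a, d] @ vs"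
    using step unfolding fpf_step_def by blast
  obtain xs p q ys where s: "ps = xs @ [p, q] @ ys" "us = flatten_pairs xs" "vs = flatten_pairs ys"
    "a = int (fst p)" "d = int (snd p)" "b = int (fst q)" "c = int (snd q)"
    by (rule flatten_pairs_split[OF eq(1) ev])
  have "p \<noteq> q" using ext s(1) by (auto simp: arc_extension_def)
  then have "fst p < fst q" "snd q < snd p"
    using nested_arcs[OF x ext, of p q] le s by simp_all
  then have "arc_extension n x (xs @ [q, p] @ ys)"
    using ext arc_extension_swap_iff unfolding s(1) by blast
  moreover have "l = flatten_pairs (xs @ [q, p] @ ys)" using eq(2) s by simp
  ultimately show ?thesis by blast
qed

lemma fpf_step_arc_extension_back:
  assumes x: "fpf_involution n x" and ext: "arc_extension n x qs" and step: "fpf_step n l (flatten_pairs qs)"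
  shows "\<exists>ps. l = flatten_pairs ps \<and> arc_extension n x ps"
proof -
  obtain us vs a b c d where ev: "even (length us)" and le: "a \<le> b" "b \<le> c" "c \<le> d"
    and eq: "l = us @ [a, d, b, c] @ vs" "flatten_pairs qs = us @ [b, c, a, d] @ vs"
    using step unfolding fpf_step_def by blast
  obtain xs q p ys where s: "qs = xs @ [q, p] @ ys" "us = flatten_pairs xs" "vs = flatten_pairs ys"
    "b = int (fst q)" "c = int (snd q)" "a = int (fst p)" "d = int (snd p)"
    by (rule flatten_pairs_split[OF eq(2) ev])
  have "p \<noteq> q" using ext s(1) by (auto simp: arc_extension_def)
  then have "fst p < fst q" "snd q < snd p"
    using nested_arcs[OF x ext, of p q] le s by simp_all
  then have "arc_extension n x (xs @ [p, q] @ ys)"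
    using ext arc_extension_swap_iff unfolding s(1) by blast
  moreover have "l = flatten_pairs (xs @ [p, q] @ ys)" using eq(1) s by simp
  ultimately show ?thesis by blast
qed

lemma fpf_step_swap:
  assumes x: "fpf_involution n x" and ext: "arc_extension n x (xs @ [p, q] @ ys)"
    and less: "fst p < fst q" "snd q < snd p"
  shows "fpf_step n (flatten_pairs (xs @ [p, q] @ ys)) (flatten_pairs (xs @ [q, p] @ ys))"
proof -
  have "q \<in> cycle_pairs n x" using ext by (auto simp: arc_extension_def)
  then have q: "fst q < snd q" by (rule cycle_pairsD(1)[OF x])
  have len: "length (xs @ [p, q] @ ys) = n" by (rule length_arc_extension[OF x ext])
  show ?thesis
    unfolding fpf_step_def
  proof (intro conjI exI)
    show "length (flatten_pairs (xs @ [p, q] @ ys)) = 2 * n"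
      "length (flatten_pairs (xs @ [q, p] @ ys)) = 2 * n" using len by simp_all
    show "flatten_pairs (xs @ [p, q] @ ys) = flatten_pairs xs @
        [int (fst p), int (snd p), int (fst q), int (snd q)] @ flatten_pairs ys"
      "flatten_pairs (xs @ [q, p] @ ys) = flatten_pairs xs @
        [int (fst q), int (snd q), int (fst p), int (snd p)] @ flatten_pairs ys" by simp_all
  qed (use less q in simp_all)
qed

section \<open>Sorting arcs by adjacent exchanges\<close>

lemma unsorted_adjacent:
  fixes f :: "'a \<Rightarrow> nat"
  assumes "\<not> sorted (map f ps)"
  obtains xs p q ys where "ps = xs @ [p, q] @ ys" "f q < f p"
proof -
  have "\<exists>xs p q ys. ps = xs @ [p, q] @ ys \<and> f q < f p"
    using assms
  proof (induction ps rule: induct_list012)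
    case (3 p q ps)
    show ?case
    proof (cases "f q < f p")
      case True
      then show ?thesis by (intro exI[of _ "[]"]) auto
    next
      case False
      then have "\<not> sorted (map f (q # ps))" using "3.prems" by (force simp del: sorted_wrt.simps simp: sorted2_simps)
      then obtain xs p' q' ys where "q # ps = xs @ [p', q'] @ ys" "f q' < f p'"
        using "3.IH"(2) by blast
      then show ?thesis by (intro exI[of _ "p # xs"]) auto
    qed
  qed simp_all
  then show ?thesis using that by blast
qed

text \<open>A termination measure for bubble sort: a key counts more the further it stands from the
  end, so exchanging an adjacent descent lowers the total by the difference of the two keys.\<close>

fun key_weight :: "('a \<Rightarrow> nat) \<Rightarrow> 'a list \<Rightarrow> nat" where
  "key_weight f [] = 0"
| "key_weight f (p # ps) = length (p # ps) * f p + key_weight f ps"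

lemma key_weight_swap:
  "f q < f p \<Longrightarrow> key_weight f (xs @ [q, p] @ ys) < key_weight f (xs @ [p, q] @ ys)"
  by (induction xs) (simp_all add: algebra_simps)

text \<open>\<open>fst\<close> and \<open>snd\<close> are injective on the arcs but not on all
  pairs, so \<open>folding_insort_key\<close> is interpreted with the set at hand as its
  carrier.\<close>

lemma (in linorder) sorted_key_list_of_set_eqI:
  assumes "inj_on f (set xs)" "sorted (map f xs)" "distinct xs"
  shows "sorted_key_list_of_set f (set xs) = xs"
proof -
  interpret folding_insort_key "(\<le>)" "(<)" "set xs" f
    by unfold_locales (rule assms(1))
  show ?thesis by (rule idem_if_sorted_distinct[OF subset_refl assms(2,3)])
qed

lemma (in linorder) sorted_key_list_of_set_inj_on:
  assumes "inj_on f A" "finite A"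
  shows "set (sorted_key_list_of_set f A) = A"
    and "sorted_wrt (<) (map f (sorted_key_list_of_set f A))"
proof -
  interpret folding_insort_key "(\<le>)" "(<)" A f
    by unfold_locales (rule assms(1))
  show "set (sorted_key_list_of_set f A) = A"
    and "sorted_wrt (<) (map f (sorted_key_list_of_set f A))" using assms(2) by simp_all
qed

lemma sorted_key_list_of_arc_extension:
  fixes f :: "nat \<times> nat \<Rightarrow> nat"
  assumes "arc_extension n x ps" "sorted (map f ps)" "inj_on f (cycle_pairs n x)"
  shows "sorted_key_list_of_set f (cycle_pairs n x) = ps"
  using sorted_key_list_of_set_eqI[of f ps] assms by (simp add: arc_extension_def)

lemma inj_on_cycle_pairs:
  assumes x: "fpf_involution n x"
  shows "inj_on fst (cycle_pairs n x)" "inj_on snd (cycle_pairs n x)"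
  using cycle_pairsD(2,3)[OF x] by (metis inj_onI prod_eqI)+

lemma fpf_le_iff: "fpf_le n = (fpf_step n)\<^sup>*\<^sup>*"
  by (intro ext) (auto simp: fpf_le_def fpf_less_def dest: rtranclpD tranclp_into_rtranclp)

lemma zero_FPF_reaches:
  assumes x: "fpf_involution n x" and ext: "arc_extension n x ps"
  shows "(fpf_step n)\<^sup>*\<^sup>* (zero_FPF n x) (flatten_pairs ps)"
  using ext
proof (induction "key_weight fst ps" arbitrary: ps rule: less_induct)
  case less
  show ?case
  proof (cases "sorted (map fst ps)")
    case True
    then show ?thesis
      using sorted_key_list_of_arc_extension[OF less.prems _ inj_on_cycle_pairs(1)[OF x]]
      by (simp add: zero_FPF_def)
  next
    case False
    then obtain xs p q ys where ps: "ps = xs @ [p, q] @ ys" "fst q < fst p"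
      by (rule unsorted_adjacent)
    \<comment> \<open>The left ends are in the wrong order, so only the right ends can justify
      \<open>p\<close> before \<open>q\<close>: \<open>q\<close> encloses \<open>p\<close>. The
      exchanged list therefore precedes \<open>ps\<close>.\<close>
    then have "snd p < snd q" using less.prems by (auto simp: arc_extension_def sorted_wrt_append)
    then have ext: "arc_extension n x (xs @ [q, p] @ ys)"
      using arc_extension_swap_iff ps less.prems by blast
    have "(fpf_step n)\<^sup>*\<^sup>* (zero_FPF n x) (flatten_pairs (xs @ [q, p] @ ys))"
      by (intro less.hyps ext) (simp only: ps(1) key_weight_swap ps(2))
    also have "fpf_step n (flatten_pairs (xs @ [q, p] @ ys)) (flatten_pairs ps)"
      unfolding ps(1) by (rule fpf_step_swap[OF x ext ps(2) \<open>snd p < snd q\<close>])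
    finally show ?thesis .
  qed
qed

lemma reaches_one_FPF:
  assumes x: "fpf_involution n x" and ext: "arc_extension n x ps"
  shows "(fpf_step n)\<^sup>*\<^sup>* (flatten_pairs ps) (one_FPF n x)"
  using ext
proof (induction "key_weight snd ps" arbitrary: ps rule: less_induct)
  case less
  show ?case
  proof (cases "sorted (map snd ps)")
    case True
    then show ?thesis
      using sorted_key_list_of_arc_extension[OF less.prems _ inj_on_cycle_pairs(2)[OF x]]
      by (simp add: one_FPF_def)
  next
    case False
    then obtain xs p q ys where ps: "ps = xs @ [p, q] @ ys" "snd q < snd p"
      by (rule unsorted_adjacent)
    \<comment> \<open>Here \<open>p\<close> encloses \<open>q\<close>, so the exchange is a step
      upwards from \<open>ps\<close>.\<close>
    then have "fst p < fst q" using less.prems by (auto simp: arc_extension_def sorted_wrt_append)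
    then have ext: "arc_extension n x (xs @ [q, p] @ ys)"
      using arc_extension_swap_iff ps less.prems by blast
    have "fpf_step n (flatten_pairs ps) (flatten_pairs (xs @ [q, p] @ ys))"
      using less.prems unfolding ps(1) by (intro fpf_step_swap[OF x] \<open>fst p < fst q\<close> ps(2))
    also have "(fpf_step n)\<^sup>*\<^sup>* (flatten_pairs (xs @ [q, p] @ ys)) (one_FPF n x)"
      by (intro less.hyps ext) (simp only: ps(1) key_weight_swap ps(2))
    finally show ?thesis .
  qed
qed

lemma sorted_key_list_arc_extension:
  assumes x: "fpf_involution n x" and f: "f = fst \<or> f = snd"
  shows "arc_extension n x (sorted_key_list_of_set f (cycle_pairs n x))"
proof -
  have "finite (cycle_pairs n x)"
    by (rule finite_subset[of _ "{1..2 * n} \<times> {1..2 * n}"]) (auto simp: cycle_pairs_def)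
  moreover have "inj_on f (cycle_pairs n x)" using f inj_on_cycle_pairs[OF x] by blast
  ultimately have *: "set (sorted_key_list_of_set f (cycle_pairs n x)) = cycle_pairs n x"
    "sorted_wrt (<) (map f (sorted_key_list_of_set f (cycle_pairs n x)))"
    using sorted_key_list_of_set_inj_on by blast+
  from *(2) have "sorted_wrt (\<lambda>p q. fst p < fst q \<or> snd p < snd q) (sorted_key_list_of_set f (cycle_pairs n x))"
    unfolding sorted_wrt_map by (rule sorted_wrt_mono_rel[rotated]) (use f in auto)
  moreover have "distinct (sorted_key_list_of_set f (cycle_pairs n x))"
    using *(2) by (simp add: strict_sorted_iff distinct_map)
  ultimately show ?thesis
    using *(1) by (simp add: arc_extension_def)
qed

section \<open>The two intervals and the shortest conjugators\<close>

lemma fpf_le_zero_iff: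
  assumes x: "fpf_involution n x"
  shows "fpf_le n (zero_FPF n x) (one_line (2 * n) u) \<longleftrightarrow> arc_extension n x (arc_list n u)"
proof
  assume "fpf_le n (zero_FPF n x) (one_line (2 * n) u)"
  \<comment> \<open>Chains pass through arbitrary integer lists, so the invariant includes being the
    flattening of a linear extension; injectivity of \<open>flatten_pairs\<close> then identifies
    \<open>qs\<close> with \<open>arc_list n u\<close>.\<close>
  then have "\<exists>qs. one_line (2 * n) u = flatten_pairs qs \<and> arc_extension n x qs"
    unfolding fpf_le_iff
  proof (induction rule: rtranclp_induct)
    case base
    show ?case using sorted_key_list_arc_extension[OF x] by (auto simp: zero_FPF_def)
  next
    case (step l l')
    then show ?case using fpf_step_arc_extension[OF x] by blast
  qed
  then show "arc_extension n x (arc_list n u)"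
    by (auto simp: flatten_pairs_eq_iff simp flip: flatten_arc_list)
next
  assume "arc_extension n x (arc_list n u)"
  from zero_FPF_reaches[OF x this] show "fpf_le n (zero_FPF n x) (one_line (2 * n) u)"
    by (simp add: fpf_le_iff flatten_arc_list)
qed

lemma fpf_le_one_iff:
  assumes x: "fpf_involution n x"
  shows "fpf_le n (one_line (2 * n) u) (one_FPF n x) \<longleftrightarrow> arc_extension n x (arc_list n u)"
proof
  assume "fpf_le n (one_line (2 * n) u) (one_FPF n x)"
  then have "\<exists>qs. one_line (2 * n) u = flatten_pairs qs \<and> arc_extension n x qs"
    unfolding fpf_le_iff
  proof (induction rule: converse_rtranclp_induct)
    case base
    show ?case using sorted_key_list_arc_extension[OF x] by (auto simp: one_FPF_def)
  next
    case (step l l')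
    then show ?case using fpf_step_arc_extension_back[OF x] by blast
  qed
  then show "arc_extension n x (arc_list n u)"
    by (auto simp: flatten_pairs_eq_iff simp flip: flatten_arc_list)
next
  assume "arc_extension n x (arc_list n u)"
  from reaches_one_FPF[OF x this] show "fpf_le n (one_line (2 * n) u) (one_FPF n x)"
    by (simp add: fpf_le_iff flatten_arc_list)
qed

text \<open>With \<open>x\<close> fixed, \<open>bound\<close> is a lower bound on the inversions of
  every conjugator, and \<open>tight\<close> describes equality. Minimality means equality once a
  single conjugator attains it.\<close>

lemma A_FPF_iff:
  assumes x: "fpf_involution n x"
  shows "w \<in> A_FPF n x \<longleftrightarrow> w \<in> Sym (2 * n) \<and> arcs_sorted n (inv w) \<and> arc_perm n (inv w) = x"
proof -
  have conj: "v \<in> fpf_conjugators n x \<longleftrightarrow> v \<in> Sym (2 * n) \<and> dem_conj n v = x" for v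
    by (simp add: fpf_conjugators_def dem_conj_def)
  have bound: "inv_num x \<le> inv_num (w_fpf n) + 2 * inv_num v"
    and tight: "inv_num x = inv_num (w_fpf n) + 2 * inv_num v \<longleftrightarrow>
      arcs_sorted n (inv v) \<and> arc_perm n (inv v) = x"
    if "v \<in> Sym (2 * n)" "dem_conj n v = x" for v
    using dem_conj_properties[OF that(1)] that(2) by auto
  \<comment> \<open>The arcs sorted by left end form a linear extension, and the inverse of the
    corresponding permutation is a conjugator that attains the bound.\<close>
  obtain u0 where u0: "u0 \<in> Sym (2 * n)"
    and "arc_list n u0 = sorted_key_list_of_set fst (cycle_pairs n x)"
    using ex_arc_list[OF x sorted_key_list_arc_extension[OF x]] by blast
  then have "arcs_sorted n u0 \<and> arc_perm n u0 = x"
    using arc_extension_arc_list_iff[OF x u0] sorted_key_list_arc_extension[OF x] by simp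
  then have v0: "inv u0 \<in> Sym (2 * n)" "dem_conj n (inv u0) = x"
    "inv_num x = inv_num (w_fpf n) + 2 * inv_num (inv u0)"
    using dem_conj_properties[OF inv_in_Sym[OF u0]] inv_in_Sym[OF u0] by (auto simp: inv_inv_Sym[OF u0])
  show ?thesis
  proof
    assume "w \<in> A_FPF n x"
    then have w: "w \<in> Sym (2 * n)" "dem_conj n w = x"
      and "cox_length (2 * n) w \<le> cox_length (2 * n) (inv u0)"
      using v0(1,2) by (simp_all add: A_FPF_def conj)
    then have "inv_num w \<le> inv_num (inv u0)" using v0(1) by (simp add: cox_length_eq_inv_num)
    with w have "inv_num x = inv_num (w_fpf n) + 2 * inv_num w" using bound[OF w] v0(3) by simp
    then show "w \<in> Sym (2 * n) \<and> arcs_sorted n (inv w) \<and> arc_perm n (inv w) = x"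
      using tight[OF w] w(1) by blast
  next
    assume w: "w \<in> Sym (2 * n) \<and> arcs_sorted n (inv w) \<and> arc_perm n (inv w) = x"
    then have D: "dem_conj n w = x" using dem_conj_properties by blast
    have "inv_num w \<le> inv_num v" if "v \<in> Sym (2 * n)" "dem_conj n v = x" for v
      using tight[of w] w D bound[OF that] by simp
    then show "w \<in> A_FPF n x" using w D by (simp add: A_FPF_def conj cox_length_eq_inv_num)
  qed
qed

theorem theorem6p25:
  fixes n :: nat and x :: "nat \<Rightarrow> nat"
  assumes "fpf_involution n x"
  shows "inv ` A_FPF n x = {u \<in> Sym (2 * n). fpf_le n (zero_FPF n x) (one_line (2 * n) u)} \<and>
         {u \<in> Sym (2 * n). fpf_le n (zero_FPF n x) (one_line (2 * n) u)} =
         {u \<in> Sym (2 * n). fpf_le n (one_line (2 * n) u) (one_FPF n x)}"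
proof -
  have "u \<in> inv ` A_FPF n x \<longleftrightarrow> u \<in> Sym (2 * n) \<and> arc_extension n x (arc_list n u)" for u
  proof
    assume "u \<in> inv ` A_FPF n x"
    then show "u \<in> Sym (2 * n) \<and> arc_extension n x (arc_list n u)"
      using A_FPF_iff[OF assms] arc_extension_arc_list_iff[OF assms] inv_in_Sym by blast
  next
    assume u: "u \<in> Sym (2 * n) \<and> arc_extension n x (arc_list n u)"
    then have "inv u \<in> A_FPF n x"
      using A_FPF_iff[OF assms, of "inv u"] arc_extension_arc_list_iff[OF assms, of u]
      by (simp add: inv_in_Sym inv_inv_Sym[of u "2 * n"])
    then show "u \<in> inv ` A_FPF n x" using u inv_inv_Sym by (metis image_eqI)
  qed
  then show ?thesis
    unfolding fpf_le_zero_iff[OF assms] fpf_le_one_iff[OF assms] by blast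
qed

end
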